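(* Let $P\in\mathbb{C}^{n\times k}$ ($k\le n$) have full column rank. Then for all $n\times n$ Hermitian positive definite matrices $A,B$, $$\delta_S^2(P^*AP,P^*BP)\le\delta_S^2(A,B).$$
   Context: For Hermitian positive definite $X,Y$ of the same size (any size): $\delta_S^2(X,Y):=\log\det\left(\frac{X+Y}{2}\right)-\frac12\log\det(XY)$. $P^*$ is the conjugate transpose of $P$. *)

theory Defs
  imports
    Complex_Main
    "Jordan_Normal_Form.Schur_Decomposition"
    "Jordan_Normal_Form.DL_Rank"
begin

text \<open>In the library notation, \<open>(A *\<^sub>v v) \<bullet>c v\<close> is the scalar \<open>v\<^sup>* A v\<close>. It is real
  for Hermitian \<open>A\<close>, so taking \<^const>\<open>Re\<close> loses nothing.\<close>

definition hermitian_pos_def :: "nat \<Rightarrow> complex mat \<Rightarrow> bool" where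
  "hermitian_pos_def n A \<longleftrightarrow>
     A \<in> carrier_mat n n \<and> mat_adjoint A = A \<and>
     (\<forall>v \<in> carrier_vec n. v \<noteq> 0\<^sub>v n \<longrightarrow> Re ((A *\<^sub>v v) \<bullet>c v) > 0)"

text \<open>The function \<open>delta_S_sq X Y\<close> is \<open>\<delta>\<^sub>S\<^sup>2(X,Y)\<close>, intended for Hermitian positive
  definite \<open>X\<close> and \<open>Y\<close> of the same size. Both determinants below are then positive real
  numbers (\<open>X * Y\<close> need not be Hermitian, but \<open>det (X * Y) = det X * det Y\<close>), so \<^const>\<open>Re\<close>
  only converts them to type \<^typ>\<open>real\<close>.\<close>

definition delta_S_sq :: "complex mat \<Rightarrow> complex mat \<Rightarrow> real" where
  "delta_S_sq X Y =
     ln (Re (det ((1 / 2) \<cdot>\<^sub>m (X + Y)))) - 1 / 2 * ln (Re (det (X * Y)))"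

end

theory Submission
  imports Defs
begin

text \<open>Enlarge \<open>P\<close> one column \<open>w\<close> at a time until it is square, when
  \<open>\<delta>\<^sub>S\<close> is invariant under the congruence. Put \<open>C = (A + B) / 2\<close> and choose \<open>w \<noteq> 0\<close>
  with \<open>P\<^sup>* C w = 0\<close>. For \<open>P' = [P | w]\<close> this gives
  \<open>det (P'\<^sup>* C P') = det (P\<^sup>* C P) (w\<^sup>* C w)\<close>, while Fischer's inequality gives
  \<open>det (P'\<^sup>* A P') \<le> det (P\<^sup>* A P) (w\<^sup>* A w)\<close> and likewise for \<open>B\<close>. So enlarging \<open>P\<close>
  increases \<open>\<delta>\<^sub>S\<^sup>2\<close> by at least \<open>log (w\<^sup>* C w) - (log (w\<^sup>* A w) + log (w\<^sup>* B w)) / 2\<close>, which is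
  nonnegative by the arithmetic-geometric mean inequality.\<close>

section \<open>Adjoints and the complex inner product\<close>

lemma dim_mat_adjoint [simp]:
  "dim_row (mat_adjoint P) = dim_col P" "dim_col (mat_adjoint P) = dim_row P"
  unfolding mat_adjoint_def by (auto simp: mat_of_rows_def)

lemma mat_adjoint_carrier [simp]:
  "P \<in> carrier_mat n k \<Longrightarrow> mat_adjoint P \<in> carrier_mat k n"
  by auto

lemma index_mat_adjoint [simp]:
  assumes "i < dim_col P" "j < dim_row P"
  shows "mat_adjoint P $$ (i, j) = conjugate (P $$ (j, i))"
  using assms unfolding mat_adjoint_def by (simp add: mat_of_rows_def)

lemma row_mat_adjoint:
  assumes "P \<in> carrier_mat n k" "i < k"
  shows "row (mat_adjoint P) i = conjugate (col P i)"
  using assms by (intro eq_vecI) auto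

lemma mat_adjoint_inner:
  fixes P :: "complex mat"
  assumes "P \<in> carrier_mat n k" "u \<in> carrier_vec n" "y \<in> carrier_vec k"
  shows "(mat_adjoint P *\<^sub>v u) \<bullet>c y = u \<bullet>c (P *\<^sub>v y)"
proof -
  have "(mat_adjoint P *\<^sub>v u) \<bullet>c y
      = (\<Sum>i<k. \<Sum>j<n. cnj (P $$ (j, i)) * u $ j * cnj (y $ i))"
    using assms by (simp add: scalar_prod_def sum_distrib_right atLeast0LessThan)
  also have "\<dots> = (\<Sum>j<n. \<Sum>i<k. cnj (P $$ (j, i)) * u $ j * cnj (y $ i))"
    by (rule sum.swap)
  also have "\<dots> = u \<bullet>c (P *\<^sub>v y)"
    using assms
    by (simp add: scalar_prod_def sum_distrib_left atLeast0LessThan mult_ac)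
  finally show ?thesis .
qed

lemma cinner_commute:
  fixes u v :: "complex vec"
  assumes "u \<in> carrier_vec n" "v \<in> carrier_vec n"
  shows "u \<bullet>c v = cnj (v \<bullet>c u)"
  using conjugate_conjugate_sprod[OF assms] conjugate_vec_sprod_comm[OF assms(2,1)] by simp

lemma hermitian_inner_commute:
  fixes A :: "complex mat"
  assumes "A \<in> carrier_mat n n" "mat_adjoint A = A" "u \<in> carrier_vec n" "v \<in> carrier_vec n"
  shows "(A *\<^sub>v u) \<bullet>c v = cnj ((A *\<^sub>v v) \<bullet>c u)"
  using mat_adjoint_inner[of A n n u v] cinner_commute[of u n "A *\<^sub>v v"] assms by simp

section \<open>Positive definite matrices, their compressions and determinants\<close>

lemma hpd_carrier: "hermitian_pos_def n A \<Longrightarrow> A \<in> carrier_mat n n"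
  and hpd_adjoint: "hermitian_pos_def n A \<Longrightarrow> mat_adjoint A = A"
  and hpd_pos: "hermitian_pos_def n A \<Longrightarrow> v \<in> carrier_vec n \<Longrightarrow> v \<noteq> 0\<^sub>v n
    \<Longrightarrow> 0 < Re ((A *\<^sub>v v) \<bullet>c v)"
  unfolding hermitian_pos_def_def by auto

lemma hpd_nonneg:
  assumes "hermitian_pos_def n A" "v \<in> carrier_vec n"
  shows "0 \<le> Re ((A *\<^sub>v v) \<bullet>c v)"
proof (cases "v = 0\<^sub>v n")
  case True
  then show ?thesis using hpd_carrier[OF assms(1)] by simp
qed (use hpd_pos[OF assms] in simp)

lemma hpd_real:
  assumes "hermitian_pos_def n A" "v \<in> carrier_vec n"
  shows "(A *\<^sub>v v) \<bullet>c v = of_real (Re ((A *\<^sub>v v) \<bullet>c v))"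
proof -
  have "(A *\<^sub>v v) \<bullet>c v \<in> \<real>"
    using hermitian_inner_commute[OF hpd_carrier hpd_adjoint assms(2,2)] assms(1)
    by (simp add: Reals_cnj_iff)
  then show ?thesis by (simp add: of_real_Re)
qed

text \<open>Exhibits a compression as the Gram matrix of the columns of \<open>P\<close> under the
  form of \<open>A\<close>. The order of the indices is reversed on the right because
  \<open>\<bullet>c\<close> conjugates its second argument.\<close>

lemma index_compression:
  fixes A :: "complex mat"
  assumes "P \<in> carrier_mat n k" "A \<in> carrier_mat n n" "i < k" "j < k"
  shows "(mat_adjoint P * A * P) $$ (i, j) = (A *\<^sub>v col P j) \<bullet>c col P i"
proof -
  have c: "mat_adjoint P \<in> carrier_mat k n" using assms(1) by simp
  have "(mat_adjoint P * A * P) $$ (i, j) = (mat_adjoint P * (A * P)) $$ (i, j)"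
    using assoc_mult_mat[OF c assms(2,1)] by simp
  also have "\<dots> = conjugate (col P i) \<bullet> (A *\<^sub>v col P j)"
    using assms row_mat_adjoint[OF assms(1,3)] col_mult2[OF assms(2,1,4)]
    by (subst index_mult_mat) simp_all
  also have "\<dots> = (A *\<^sub>v col P j) \<bullet>c col P i"
    using assms by (intro conjugate_vec_sprod_comm[symmetric, of _ n]) auto
  finally show ?thesis .
qed

lemma compression_inner:
  fixes A :: "complex mat"
  assumes "P \<in> carrier_mat n k" "A \<in> carrier_mat n n" "x \<in> carrier_vec k" "y \<in> carrier_vec k"
  shows "((mat_adjoint P * A * P) *\<^sub>v x) \<bullet>c y = (A *\<^sub>v (P *\<^sub>v x)) \<bullet>c (P *\<^sub>v y)"
proof -
  have c: "mat_adjoint P \<in> carrier_mat k n" using assms(1) by simp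
  have "(mat_adjoint P * A * P) *\<^sub>v x = mat_adjoint P *\<^sub>v (A *\<^sub>v (P *\<^sub>v x))"
    using assms assoc_mult_mat_vec[OF mult_carrier_mat[OF c assms(2)] assms(1,3)]
      assoc_mult_mat_vec[OF c assms(2), of "P *\<^sub>v x"] by simp
  then show ?thesis using mat_adjoint_inner[OF assms(1) _ assms(4)] assms by simp
qed

text \<open>Full column rank in trivial-kernel form. Positive definiteness of a compression needs
  exactly this form, and it passes easily to a matrix with one more column; the rank hypothesis is
  converted to it once.\<close>

definition inj_mat :: "nat \<Rightarrow> nat \<Rightarrow> complex mat \<Rightarrow> bool" where
  "inj_mat n k P \<longleftrightarrow> P \<in> carrier_mat n k \<and>
     (\<forall>x \<in> carrier_vec k. P *\<^sub>v x = 0\<^sub>v n \<longrightarrow> x = 0\<^sub>v k)"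

text \<open>The form of the compression at \<open>x\<close> is the form of \<open>A\<close> at
  \<open>P x\<close>, and \<open>P x\<close> is nonzero when \<open>x\<close> is.\<close>

lemma hpd_compression:
  assumes "hermitian_pos_def n A" "inj_mat n k P"
  shows "hermitian_pos_def k (mat_adjoint P * A * P)"
proof -
  note A = hpd_carrier[OF assms(1)]
  have P: "P \<in> carrier_mat n k" using assms(2) by (simp add: inj_mat_def)
  have c: "mat_adjoint P * A * P \<in> carrier_mat k k"
    using A P by (meson mat_adjoint_carrier mult_carrier_mat)
  have "mat_adjoint (mat_adjoint P * A * P) = mat_adjoint P * A * P"
  proof (rule eq_matI)
    fix i j assume "i < dim_row (mat_adjoint P * A * P)" "j < dim_col (mat_adjoint P * A * P)"
    then have ij: "i < k" "j < k" using c by auto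
    have col: "col P l \<in> carrier_vec n" for l using P by auto
    have "mat_adjoint (mat_adjoint P * A * P) $$ (i, j)
        = cnj ((mat_adjoint P * A * P) $$ (j, i))"
      using index_mat_adjoint[of i "mat_adjoint P * A * P" j] ij P by simp
    also have "\<dots> = (mat_adjoint P * A * P) $$ (i, j)"
      unfolding index_compression[OF P A ij] index_compression[OF P A ij(2,1)]
      using hermitian_inner_commute[OF A hpd_adjoint[OF assms(1)] col col, of j i] by simp
    finally show "mat_adjoint (mat_adjoint P * A * P) $$ (i, j) = (mat_adjoint P * A * P) $$ (i, j)" .
  qed (use c mat_adjoint_carrier[OF c] in auto)
  moreover have "0 < Re (((mat_adjoint P * A * P) *\<^sub>v x) \<bullet>c x)"
    if "x \<in> carrier_vec k" "x \<noteq> 0\<^sub>v k" for x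
  proof -
    have "P *\<^sub>v x \<noteq> 0\<^sub>v n" using assms(2) that by (auto simp: inj_mat_def)
    then show ?thesis
      using hpd_pos[OF assms(1), of "P *\<^sub>v x"] P that compression_inner[OF P A that(1,1)] by simp
  qed
  ultimately show ?thesis using c by (simp add: hermitian_pos_def_def)
qed

text \<open>A Schur decomposition gives a similar triangular matrix with the eigenvalues on its
  diagonal, so the determinant is their product. Each eigenvalue is a Rayleigh quotient, hence a
  positive real.\<close>

lemma hpd_det_pos:
  assumes "hermitian_pos_def n A"
  shows "det A = of_real (Re (det A))" "0 < Re (det A)"
proof -
  note A = hpd_carrier[OF assms]
  obtain es where es: "char_poly A = (\<Prod>a\<leftarrow>es. [:- a, 1:])"
    using char_poly_factorized[OF A] by blast
  obtain B P Q where "schur_decomposition A es = (B, P, Q)" by (metis prod_cases3)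
  from schur_decomposition[OF A es this]
  have sim: "similar_mat_wit A B P Q" and ut: "upper_triangular B" and diag: "diag_mat B = es"
    by auto
  have B: "B \<in> carrier_mat n n" using similar_mat_witD2[OF A sim] by auto
  have "det A = det B" using sim by (intro det_similar) (auto simp: similar_mat_def)
  also have "\<dots> = prod_list es" using det_upper_triangular[OF ut B] diag by simp
  finally have det: "det A = prod_list es" .
  have "\<exists>r>0. e = complex_of_real r" if "e \<in> set es" for e
  proof -
    have "poly (char_poly A) e = 0"
      using that unfolding es poly_prod_list by (auto simp: prod_list_zero_iff image_iff)
    then obtain v where v: "v \<in> carrier_vec n" "v \<noteq> 0\<^sub>v n" "A *\<^sub>v v = e \<cdot>\<^sub>v v"
      using eigenvalue_root_char_poly[OF A] A by (auto simp: eigenvalue_def eigenvector_def)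
    \<comment> \<open>In the order on the complex numbers, being positive includes having imaginary
      part zero, so this also shows that the squared norm is real.\<close>
    have "0 < v \<bullet>c v" using v by simp
    then obtain s where s: "v \<bullet>c v = of_real s" "0 < s"
      by (cases "v \<bullet>c v") (auto simp: less_complex_def complex_eq_iff)
    define r where "r = Re ((A *\<^sub>v v) \<bullet>c v)"
    have "of_real r = e * of_real s"
      using hpd_real[OF assms v(1)] v s by (simp add: r_def)
    moreover have "0 < r" using hpd_pos[OF assms v(1,2)] by (simp add: r_def)
    ultimately have "e = of_real (r / s)" "0 < r / s" using s by (auto simp: field_simps)
    then show ?thesis by blast
  qed
  then have "\<exists>r>0. prod_list es = complex_of_real r"
  proof (induction es)
    case Nil
    show ?case by (rule exI[of _ 1]) simp
  next
    case (Cons e es)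
    obtain r s where "r > 0" "e = of_real r" "s > 0" "prod_list es = complex_of_real s"
      using Cons by (metis list.set_intros(1,2))
    then show ?case by (intro exI[of _ "r * s"]) simp
  qed
  then show "det A = of_real (Re (det A))" "0 < Re (det A)" unfolding det by auto
qed

section \<open>Appending a column and its effect on the determinant of a compression\<close>

definition append_col :: "complex mat \<Rightarrow> complex vec \<Rightarrow> complex mat" where
  "append_col P w = mat (dim_row P) (Suc (dim_col P))
     (\<lambda>(i, j). if j < dim_col P then P $$ (i, j) else w $ i)"

lemma append_col_carrier [simp]:
  "P \<in> carrier_mat n k \<Longrightarrow> append_col P w \<in> carrier_mat n (Suc k)"
  unfolding append_col_def by auto

lemma col_append_col:
  assumes "P \<in> carrier_mat n k" "w \<in> carrier_vec n"
  shows "j < k \<Longrightarrow> col (append_col P w) j = col P j" "col (append_col P w) k = w"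
  using assms unfolding append_col_def by auto

lemma append_col_mult_vec:
  assumes "P \<in> carrier_mat n k" "w \<in> carrier_vec n" "x \<in> carrier_vec (Suc k)"
  shows "append_col P w *\<^sub>v x = P *\<^sub>v vec k (\<lambda>i. x $ i) + x $ k \<cdot>\<^sub>v w"
  using assms by (intro eq_vecI) (auto simp: append_col_def scalar_prod_def mult.commute)

text \<open>The orthogonality makes the last column of the enlarged Gram matrix vanish above its
  diagonal entry. The matrix is then block lower triangular, and its determinant is the product of
  the determinants of the two diagonal blocks.\<close>

lemma det_compression_append_orthogonal:
  assumes P: "P \<in> carrier_mat n k" and w: "w \<in> carrier_vec n" and A: "A \<in> carrier_mat n n"
    and orth: "mat_adjoint P *\<^sub>v (A *\<^sub>v w) = 0\<^sub>v k"
  shows "det (mat_adjoint (append_col P w) * A * append_col P w)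
    = det (mat_adjoint P * A * P) * ((A *\<^sub>v w) \<bullet>c w)"
proof -
  let ?G = "mat_adjoint (append_col P w) * A * append_col P w"
  \<comment> \<open>\<open>A\<close> is not assumed Hermitian, so the lower left block need not
    vanish; it is copied from \<open>?G\<close> as it is.\<close>
  let ?R = "mat 1 k (\<lambda>(i, j). ?G $$ (k, j))"
  let ?D = "mat 1 1 (\<lambda>(i, j). (A *\<^sub>v w) \<bullet>c w)"
  have P': "append_col P w \<in> carrier_mat n (Suc k)" using P by simp
  have G: "?G \<in> carrier_mat (Suc k) (Suc k)"
    using A P' by (meson mat_adjoint_carrier mult_carrier_mat)
  have c: "mat_adjoint P * A * P \<in> carrier_mat k k"
    using A P by (meson mat_adjoint_carrier mult_carrier_mat)
  have zero: "(A *\<^sub>v w) \<bullet>c col P i = 0" if "i < k" for i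
  proof -
    have "(A *\<^sub>v w) \<bullet>c col P i = conjugate (col P i) \<bullet> (A *\<^sub>v w)"
      using A P w that by (intro conjugate_vec_sprod_comm[of _ n]) auto
    also have "\<dots> = (mat_adjoint P *\<^sub>v (A *\<^sub>v w)) $ i"
      using that P row_mat_adjoint[OF P that] by (subst index_mult_mat_vec) auto
    finally show ?thesis using orth that by simp
  qed
  have "?G = four_block_mat (mat_adjoint P * A * P) (0\<^sub>m k 1) ?R ?D"
    (is "_ = ?F")
  proof (rule eq_matI)
    fix i j assume "i < dim_row ?F" "j < dim_col ?F"
    then have ij: "i < Suc k" "j < Suc k" using c by auto
    have F: "?F $$ (i, j) = (if i < k then if j < k then (mat_adjoint P * A * P) $$ (i, j) else 0
        else if j < k then ?G $$ (k, j) else (A *\<^sub>v w) \<bullet>c w)"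
      using ij P by (subst index_mat_four_block) auto
    show "?G $$ (i, j) = ?F $$ (i, j)"
    proof (cases "i < k")
      case True
      then show ?thesis
        unfolding F index_compression[OF P' A ij] using ij index_compression[OF P A True]
        by (cases "j < k") (simp_all add: col_append_col[OF P w] zero less_Suc_eq)
    next
      case False
      then have "i = k" using ij by simp
      then show ?thesis
        unfolding F using ij index_compression[OF P' A ij]
        by (cases "j < k") (simp_all add: col_append_col[OF P w] less_Suc_eq)
    qed
  qed (use carrier_matD[OF P] carrier_matD[OF P'] in simp_all)
  then have "det ?G = det (mat_adjoint P * A * P) * det ?D"
    using det_four_block_mat_upper_right_zero[OF c refl, of ?R 1 ?D] by simp
  then show ?thesis by (simp add: det_def)
qed

lemma mat_adjoint_mult:
  fixes A B :: "complex mat"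
  assumes "A \<in> carrier_mat n m" "B \<in> carrier_mat m k"
  shows "mat_adjoint (A * B) = mat_adjoint B * mat_adjoint A"
  using assms by (intro eq_matI) (auto simp: scalar_prod_def mult.commute)

lemma det_mat_adjoint:
  fixes A :: "complex mat"
  assumes "A \<in> carrier_mat n n"
  shows "det (mat_adjoint A) = cnj (det A)"
proof -
  interpret cnj: comm_ring_hom cnj by unfold_locales auto
  have "mat_adjoint A = map_mat cnj (transpose_mat A)"
    using assms by (intro eq_matI) auto
  then show ?thesis using cnj.hom_det[of "transpose_mat A"] det_transpose[OF assms] by simp
qed

text \<open>Regrouping gives the compression by \<open>T\<close> of the compression by
  \<open>P\<close>, which contributes \<open>det T\<close> and its conjugate. This serves the shear
  below, where \<open>det T = 1\<close>, and later the invariance under congruence.\<close>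

lemma det_compression_mult:
  fixes A :: "complex mat"
  assumes P: "P \<in> carrier_mat n k" and A: "A \<in> carrier_mat n n" and T: "T \<in> carrier_mat k k"
  shows "det (mat_adjoint (P * T) * A * (P * T))
    = of_real ((cmod (det T))\<^sup>2) * det (mat_adjoint P * A * P)"
proof -
  have P': "mat_adjoint P \<in> carrier_mat k n" and T': "mat_adjoint T \<in> carrier_mat k k"
    using P T by auto
  have PA: "mat_adjoint P * A \<in> carrier_mat k n" using P' A by (rule mult_carrier_mat)
  have G: "mat_adjoint P * A * P \<in> carrier_mat k k" using PA P by (rule mult_carrier_mat)
  have "mat_adjoint (P * T) * A * (P * T) = mat_adjoint T * (mat_adjoint P * A) * (P * T)"
    using assoc_mult_mat[OF T' P' A] mat_adjoint_mult[OF P T] by simp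
  also have "\<dots> = mat_adjoint T * (mat_adjoint P * A * P * T)"
    using assoc_mult_mat[OF T' PA mult_carrier_mat[OF P T]] assoc_mult_mat[OF PA P T] by simp
  finally have "det (mat_adjoint (P * T) * A * (P * T))
      = cnj (det T) * (det (mat_adjoint P * A * P) * det T)"
    using det_mult[OF T' mult_carrier_mat[OF G T]] det_mult[OF G T] det_mat_adjoint[OF T] by simp
  then show ?thesis by (simp add: complex_norm_square mult_ac flip: of_real_power)
qed

lemma det_compression_append_shear:
  fixes A :: "complex mat"
  assumes P: "P \<in> carrier_mat n k" and w: "w \<in> carrier_vec n" and A: "A \<in> carrier_mat n n"
    and y: "y \<in> carrier_vec k"
  shows "det (mat_adjoint (append_col P (w + P *\<^sub>v y)) * A * append_col P (w + P *\<^sub>v y))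
    = det (mat_adjoint (append_col P w) * A * append_col P w)"
proof -
  let ?P = "append_col P w" and ?P' = "append_col P (w + P *\<^sub>v y)"
  \<comment> \<open>\<open>T\<close> is the identity with its last column replaced by
    \<open>y\<close> followed by 1. Multiplying by it on the right adds \<open>P y\<close> to the
    last column, and being unit upper triangular it has determinant 1.\<close>
  define T where "T = append_col (mat (Suc k) k (\<lambda>(i, j). if i = j then 1 else 0))
    (vec (Suc k) (\<lambda>i. if i < k then y $ i else 1))"
  have T: "T \<in> carrier_mat (Suc k) (Suc k)" unfolding T_def by simp
  have P': "?P \<in> carrier_mat n (Suc k)" using P by simp
  have "upper_triangular T" unfolding T_def append_col_def by auto
  moreover have "diag_mat T = replicate (Suc k) 1"
    unfolding T_def append_col_def diag_mat_def
    by (intro nth_equalityI) (auto simp: less_Suc_eq nth_append simp del: replicate_Suc)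
  ultimately have "det T = 1" using det_upper_triangular[OF _ T] by simp
  have "?P' = ?P * T"
  proof (rule eq_matI)
    fix i j assume "i < dim_row (?P * T)" "j < dim_col (?P * T)"
    then have ij: "i < n" "j < Suc k" using P' T by auto
    have "(?P * T) $$ (i, j) = (\<Sum>l<Suc k. ?P $$ (i, l) * T $$ (l, j))"
      using ij P' T by (simp add: scalar_prod_def atLeast0LessThan)
    also have "\<dots> = ?P' $$ (i, j)"
      using ij P w y
      by (cases "j < k") (auto simp: T_def append_col_def scalar_prod_def atLeast0LessThan
          if_distrib[of "\<lambda>x. _ * x"] cong: if_cong)
    finally show "?P' $$ (i, j) = (?P * T) $$ (i, j)" ..
  qed (use P T in \<open>auto simp: append_col_def\<close>)
  then show ?thesis using det_compression_mult[OF P' A T] \<open>det T = 1\<close> by simp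
qed

section \<open>Fischer's inequality for one appended column\<close>

lemma hpd_solve:
  assumes "hermitian_pos_def n A" "b \<in> carrier_vec n"
  obtains y where "y \<in> carrier_vec n" "A *\<^sub>v y = b"
proof -
  note A = hpd_carrier[OF assms(1)]
  have "det A \<noteq> 0" using hpd_det_pos[OF assms(1)] by force
  from det_non_zero_imp_unit[OF A this, of "()"] obtain B where
    B: "B \<in> carrier_mat n n" "A * B = 1\<^sub>m n"
    unfolding Units_def by (auto simp: ring_mat_simps)
  show thesis
  proof
    show "A *\<^sub>v (B *\<^sub>v b) = b"
      using assoc_mult_mat_vec[OF A B(1) assms(2)] B(2) assms(2) by simp
  qed (use B assms in auto)
qed

text \<open>Replacing \<open>w\<close> by \<open>w + P y\<close> leaves the determinant unchanged; choosing \<open>y\<close> so that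
  \<open>A (w + P y)\<close> is orthogonal to the columns of \<open>P\<close> minimises the quadratic form.\<close>
lemma fischer_append_col:
  assumes hpd: "hermitian_pos_def n A" and inj: "inj_mat n k P" and w: "w \<in> carrier_vec n"
  shows "Re (det (mat_adjoint (append_col P w) * A * append_col P w))
    \<le> Re (det (mat_adjoint P * A * P)) * Re ((A *\<^sub>v w) \<bullet>c w)"
proof -
  note A = hpd_carrier[OF hpd]
  have P: "P \<in> carrier_mat n k" using inj by (simp add: inj_mat_def)
  note P' = mat_adjoint_carrier[OF P]
  note G = hpd_compression[OF hpd inj]
  \<comment> \<open>The condition that \<open>A (w + P y)\<close> be orthogonal to the columns of
    \<open>P\<close> is a linear system in \<open>y\<close> whose matrix is the compression of
    \<open>A\<close>; it is solvable because that compression is positive definite.\<close>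
  have "- (mat_adjoint P *\<^sub>v (A *\<^sub>v w)) \<in> carrier_vec k"
    using mult_mat_vec_carrier[OF P' mult_mat_vec_carrier[OF A w]] by simp
  from hpd_solve[OF G this] obtain y where y: "y \<in> carrier_vec k"
    and "(mat_adjoint P * A * P) *\<^sub>v y = - (mat_adjoint P *\<^sub>v (A *\<^sub>v w))" .
  then have eq: "mat_adjoint P *\<^sub>v (A *\<^sub>v (P *\<^sub>v y)) = - (mat_adjoint P *\<^sub>v (A *\<^sub>v w))"
    using assoc_mult_mat_vec[OF mult_carrier_mat[OF P' A] P y]
      assoc_mult_mat_vec[OF P' A, of "P *\<^sub>v y"] P by simp
  define u where "u = P *\<^sub>v y"
  have u: "u \<in> carrier_vec n" unfolding u_def using P y by simp
  define w' where "w' = w + u"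
  have w': "w' \<in> carrier_vec n" unfolding w'_def using u w by simp
  have Aw': "A *\<^sub>v w' = A *\<^sub>v w + A *\<^sub>v u"
    unfolding w'_def using A w u by (rule mult_add_distrib_mat_vec)
  have orth: "mat_adjoint P *\<^sub>v (A *\<^sub>v w') = 0\<^sub>v k"
    unfolding Aw' using mult_add_distrib_mat_vec[OF P', of "A *\<^sub>v w" "A *\<^sub>v u"] A w u P' eq
    by (simp add: u_def)
  \<comment> \<open>Pythagoras for the form of \<open>A\<close>: orthogonality of \<open>w'\<close>
    and \<open>u\<close>, read in both orders, makes the form at \<open>w'\<close> equal to the form
    at \<open>w\<close> minus the form at \<open>u\<close>.\<close>
  have 0: "(A *\<^sub>v w') \<bullet>c u = 0"
    using mat_adjoint_inner[OF P _ y, of "A *\<^sub>v w'"] A w' orth y unfolding u_def by simp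
  then have "(A *\<^sub>v u) \<bullet>c w' = 0"
    using hermitian_inner_commute[OF A hpd_adjoint[OF hpd] u w'] by simp
  then have 1: "(A *\<^sub>v u) \<bullet>c w + (A *\<^sub>v u) \<bullet>c u = 0"
    unfolding w'_def using A u w
    by (simp add: conjugate_add_vec[of _ n] scalar_prod_add_distrib[of _ n])
  have "(A *\<^sub>v w') \<bullet>c w' = (A *\<^sub>v w') \<bullet> (conjugate w + conjugate u)"
    using conjugate_add_vec[OF w u] by (simp add: w'_def)
  also have "\<dots> = (A *\<^sub>v w') \<bullet>c w + (A *\<^sub>v w') \<bullet>c u"
    using A u w w' by (intro scalar_prod_add_distrib[of _ n]) auto
  also have "\<dots> = (A *\<^sub>v w) \<bullet>c w + (A *\<^sub>v u) \<bullet>c w"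
    using add_scalar_prod_distrib[of "A *\<^sub>v w" n "A *\<^sub>v u" "conjugate w"] A u w
    by (simp add: 0 flip: Aw')
  finally have "(A *\<^sub>v w') \<bullet>c w' = (A *\<^sub>v w) \<bullet>c w - (A *\<^sub>v u) \<bullet>c u"
    using 1 by (simp add: algebra_simps add_eq_0_iff)
  then have le: "Re ((A *\<^sub>v w') \<bullet>c w') \<le> Re ((A *\<^sub>v w) \<bullet>c w)"
    using hpd_nonneg[OF hpd u] by simp
  have "det (mat_adjoint (append_col P w) * A * append_col P w)
      = det (mat_adjoint P * A * P) * ((A *\<^sub>v w') \<bullet>c w')"
    using det_compression_append_shear[OF P w A y]
      det_compression_append_orthogonal[OF P w' A orth] by (simp add: w'_def u_def)
  also have "\<dots> = of_real (Re (det (mat_adjoint P * A * P)) * Re ((A *\<^sub>v w') \<bullet>c w'))"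
    using hpd_real[OF hpd w'] hpd_det_pos(1)[OF G] by (metis of_real_mult)
  finally show ?thesis
    using mult_left_mono[OF le, of "Re (det (mat_adjoint P * A * P))"] hpd_det_pos(2)[OF G]
    by simp
qed

section \<open>Kernel vectors, and injectivity of the matrices involved\<close>

lemma wide_mat_kernel:
  fixes M :: "complex mat"
  assumes M: "M \<in> carrier_mat k n" and "k < n"
  obtains w where "w \<in> carrier_vec n" "w \<noteq> 0\<^sub>v n" "M *\<^sub>v w = 0\<^sub>v k"
proof -
  \<comment> \<open>Pad \<open>M\<close> with zero rows to a square matrix. Since
    \<open>k < n\<close>, row \<open>k\<close> of \<open>N\<close> is zero, so the transpose
    annihilates \<open>unit_vec n k\<close> and \<open>N\<close> is singular.\<close>
  define N where "N = mat n n (\<lambda>(i, j). if i < k then M $$ (i, j) else 0)"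
  have N: "N \<in> carrier_mat n n" unfolding N_def by simp
  have "transpose_mat N *\<^sub>v unit_vec n k = 0\<^sub>v n"
    using \<open>k < n\<close> by (intro eq_vecI) (auto simp: N_def)
  moreover have "unit_vec n k \<noteq> (0\<^sub>v n :: complex vec)"
    using \<open>k < n\<close> by (metis index_unit_vec(1) index_zero_vec(1) one_neq_zero)
  ultimately have "det N = 0"
    using det_0_iff_vec_prod_zero[of "transpose_mat N" n] det_transpose[OF N] N
    by (metis transpose_carrier_mat unit_vec_carrier)
  then obtain w where w: "w \<in> carrier_vec n" "w \<noteq> 0\<^sub>v n" "N *\<^sub>v w = 0\<^sub>v n"
    using det_0_iff_vec_prod_zero[OF N] by blast
  have "M *\<^sub>v w = 0\<^sub>v k"
  proof (rule eq_vecI)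
    fix i assume "i < dim_vec (0\<^sub>v k :: complex vec)"
    then have i: "i < k" "i < n" using \<open>k < n\<close> by auto
    have "(M *\<^sub>v w) $ i = (N *\<^sub>v w) $ i"
      using i M w(1) by (simp add: N_def scalar_prod_def)
    then show "(M *\<^sub>v w) $ i = 0\<^sub>v k $ i" using w i by simp
  qed (use M in simp)
  then show thesis using that w by blast
qed

text \<open>Pair a vanishing combination of \<open>P z\<close> and \<open>w\<close> with
  \<open>C w\<close>. Orthogonality removes \<open>P z\<close>, and positivity of the form of
  \<open>C\<close> at \<open>w\<close> forces the coefficient of \<open>w\<close> to be zero;
  injectivity of \<open>P\<close> then gives \<open>z = 0\<close>.\<close>

lemma inj_mat_append_col:
  assumes hpd: "hermitian_pos_def n C" and inj: "inj_mat n k P"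
    and w: "w \<in> carrier_vec n" "w \<noteq> 0\<^sub>v n" and orth: "mat_adjoint P *\<^sub>v (C *\<^sub>v w) = 0\<^sub>v k"
  shows "inj_mat n (Suc k) (append_col P w)"
proof -
  note C = hpd_carrier[OF hpd]
  have P: "P \<in> carrier_mat n k" using inj by (simp add: inj_mat_def)
  have "x = 0\<^sub>v (Suc k)" if x: "x \<in> carrier_vec (Suc k)" and 0: "append_col P w *\<^sub>v x = 0\<^sub>v n" for x
  proof -
    define z where "z = vec k (\<lambda>i. x $ i)"
    have z: "z \<in> carrier_vec k" unfolding z_def by simp
    have sum: "P *\<^sub>v z + x $ k \<cdot>\<^sub>v w = 0\<^sub>v n"
      using 0 append_col_mult_vec[OF P w(1) x] by (simp add: z_def)
    have "(C *\<^sub>v w) \<bullet>c (P *\<^sub>v z) = 0"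
      using mat_adjoint_inner[OF P _ z, of "C *\<^sub>v w"] C w orth z by simp
    moreover have "(C *\<^sub>v w) \<bullet>c (P *\<^sub>v z + x $ k \<cdot>\<^sub>v w)
        = (C *\<^sub>v w) \<bullet>c (P *\<^sub>v z) + cnj (x $ k) * ((C *\<^sub>v w) \<bullet>c w)"
      using C P w z
      by (simp add: conjugate_add_vec[of _ n] scalar_prod_add_distrib[of _ n] conjugate_smult_vec)
    ultimately have "cnj (x $ k) * ((C *\<^sub>v w) \<bullet>c w) = 0"
      using sum C w by simp
    moreover have "(C *\<^sub>v w) \<bullet>c w \<noteq> 0" using hpd_pos[OF hpd w] by force
    ultimately have xk: "x $ k = 0" by simp
    moreover have "0 \<cdot>\<^sub>v w = 0\<^sub>v n" using w by auto
    ultimately have "P *\<^sub>v z = 0\<^sub>v n" using sum P z by simp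
    then have "z = 0\<^sub>v k" using inj z by (simp add: inj_mat_def)
    then have "x $ i = 0" if "i < k" for i using that by (metis z_def index_vec index_zero_vec(1))
    then show ?thesis using xk x by (intro eq_vecI) (auto simp: less_Suc_eq)
  qed
  then show ?thesis using P by (simp add: inj_mat_def)
qed

text \<open>Linear independence is a property of the set of columns and cannot see a repeated
  column, so distinctness is proved first by counting: a maximal independent subset of the columns
  has \<open>k\<close> elements, while there are only \<open>k\<close> columns in the list.\<close>

lemma inj_mat_if_full_rank:
  assumes P: "P \<in> carrier_mat n k" and rank: "vec_space.rank n P = k"
  shows "inj_mat n k P"
proof -
  interpret vec_space "TYPE(complex)" n .
  obtain S where S: "maximal S (\<lambda>T. T \<subseteq> set (cols P) \<and> lin_indpt T)"
    using maximal_exists[of "\<lambda>T. T \<subseteq> set (cols P) \<and> lin_indpt T" "card (set (cols P))" "{}"]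
    by (meson List.finite_set card_mono empty_iff empty_subsetI finite_lin_indpt2 rev_finite_subset)
  then have "k \<le> card (set (cols P))"
    using rank_card_indpt[OF P S] rank by (simp add: card_mono maximal_def)
  then have dist: "distinct (cols P)"
    using P by (metis card_distinct card_length cols_length carrier_matD(2) le_antisym)
  then have "lin_indpt (set (cols P))" using full_rank_lin_indpt[OF P rank] by simp
  then show ?thesis using lin_depI[OF P _ _ _ dist] P unfolding inj_mat_def by blast
qed

section \<open>Midpoints and the behaviour of \<open>delta_S_sq\<close> under compression\<close>

lemma hpd_midpoint:
  assumes "hermitian_pos_def n A" "hermitian_pos_def n B"
  shows "hermitian_pos_def n ((1 / 2) \<cdot>\<^sub>m (A + B))"
    and "v \<in> carrier_vec n \<Longrightarrow> Re (((1 / 2) \<cdot>\<^sub>m (A + B) *\<^sub>v v) \<bullet>c v)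
      = (Re ((A *\<^sub>v v) \<bullet>c v) + Re ((B *\<^sub>v v) \<bullet>c v)) / 2"
proof -
  note A = hpd_carrier[OF assms(1)] and B = hpd_carrier[OF assms(2)]
  show *: "Re (((1 / 2) \<cdot>\<^sub>m (A + B) *\<^sub>v v) \<bullet>c v)
      = (Re ((A *\<^sub>v v) \<bullet>c v) + Re ((B *\<^sub>v v) \<bullet>c v)) / 2" if "v \<in> carrier_vec n" for v
  proof -
    have "(1 / 2) \<cdot>\<^sub>m (A + B) *\<^sub>v v = (1 / 2) \<cdot>\<^sub>v (A *\<^sub>v v + B *\<^sub>v v)"
      using add_mult_distrib_mat_vec[OF A B that] A B that
      by (intro eq_vecI) (auto simp: add_scalar_prod_distrib[of _ n])
    then show ?thesis using A B that by (simp add: add_scalar_prod_distrib[of _ n])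
  qed
  have "mat_adjoint ((1 / 2) \<cdot>\<^sub>m (A + B)) = (1 / 2) \<cdot>\<^sub>m (A + B)"
  proof (rule eq_matI)
    fix i j assume "i < dim_row ((1 / 2) \<cdot>\<^sub>m (A + B))" "j < dim_col ((1 / 2) \<cdot>\<^sub>m (A + B))"
    then have ij: "i < n" "j < n" using A B by auto
    have "cnj (A $$ (j, i)) = A $$ (i, j)" "cnj (B $$ (j, i)) = B $$ (i, j)"
      using index_mat_adjoint[of i A j] index_mat_adjoint[of i B j] ij A B
        hpd_adjoint[OF assms(1)] hpd_adjoint[OF assms(2)] by auto
    then show "mat_adjoint ((1 / 2) \<cdot>\<^sub>m (A + B)) $$ (i, j) = ((1 / 2) \<cdot>\<^sub>m (A + B)) $$ (i, j)"
      using ij A B by simp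
  qed (use A B in auto)
  then show "hermitian_pos_def n ((1 / 2) \<cdot>\<^sub>m (A + B))"
    using A B hpd_pos[OF assms(1)] hpd_pos[OF assms(2)]
    by (simp add: hermitian_pos_def_def * add_pos_pos)
qed

text \<open>Both determinants are real, so \<open>Re\<close> respects their product, and both are
  positive, so \<open>ln\<close> splits it.\<close>

lemma delta_S_sq_hpd:
  assumes "hermitian_pos_def n A" "hermitian_pos_def n B"
  shows "delta_S_sq A B = ln (Re (det ((1 / 2) \<cdot>\<^sub>m (A + B))))
    - (ln (Re (det A)) + ln (Re (det B))) / 2"
proof -
  note a = hpd_det_pos[OF assms(1)] and b = hpd_det_pos[OF assms(2)]
  have "det (A * B) = of_real (Re (det A) * Re (det B))"
    using det_mult[OF hpd_carrier[OF assms(1)] hpd_carrier[OF assms(2)]] a(1) b(1)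
    by (metis of_real_mult)
  then show ?thesis using a(2) b(2) by (simp add: delta_S_sq_def ln_mult)
qed

text \<open>Compression is linear, so the first term of \<open>delta_S_sq\<close> for two
  compressions is governed by the compression of the midpoint of \<open>A\<close> and
  \<open>B\<close>.\<close>

lemma compression_midpoint:
  fixes A B :: "complex mat"
  assumes "P \<in> carrier_mat n k" "A \<in> carrier_mat n n" "B \<in> carrier_mat n n"
  shows "(1 / 2) \<cdot>\<^sub>m (mat_adjoint P * A * P + mat_adjoint P * B * P)
    = mat_adjoint P * ((1 / 2) \<cdot>\<^sub>m (A + B)) * P"
proof -
  note P' = mat_adjoint_carrier[OF assms(1)]
  have "mat_adjoint P * ((1 / 2) \<cdot>\<^sub>m (A + B)) * P = (1 / 2) \<cdot>\<^sub>m (mat_adjoint P * (A + B) * P)"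
    using mult_smult_distrib[OF P' add_carrier_mat[OF assms(3)], of "1 / 2" A]
      mult_smult_assoc_mat[OF mult_carrier_mat[OF P' add_carrier_mat[OF assms(3)]] assms(1)] by simp
  also have "mat_adjoint P * (A + B) * P = mat_adjoint P * A * P + mat_adjoint P * B * P"
    using mult_add_distrib_mat[OF P' assms(2,3)]
      add_mult_distrib_mat[OF mult_carrier_mat[OF P' assms(2)] mult_carrier_mat[OF P' assms(3)] assms(1)]
    by simp
  finally show ?thesis ..
qed

text \<open>Injectivity of the enlarged matrix is delivered along with the inequality so that the
  enlargement can be repeated.\<close>

lemma delta_S_sq_append_col:
  assumes A: "hermitian_pos_def n A" and B: "hermitian_pos_def n B"
    and inj: "inj_mat n k P" and "k < n"
  obtains w where "inj_mat n (Suc k) (append_col P w)"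
    "delta_S_sq (mat_adjoint P * A * P) (mat_adjoint P * B * P)
      \<le> delta_S_sq (mat_adjoint (append_col P w) * A * append_col P w)
          (mat_adjoint (append_col P w) * B * append_col P w)"
proof -
  define C where "C = (1 / 2) \<cdot>\<^sub>m (A + B)"
  have C: "hermitian_pos_def n C" unfolding C_def using A B by (rule hpd_midpoint)
  note cA = hpd_carrier[OF A] and cB = hpd_carrier[OF B] and cC = hpd_carrier[OF C]
  have P: "P \<in> carrier_mat n k" using inj by (simp add: inj_mat_def)
  note P' = mat_adjoint_carrier[OF P]
  \<comment> \<open>The matrix \<open>mat_adjoint P * C\<close> has fewer rows than columns, so it
    has a nonzero kernel vector.\<close>
  obtain w where w: "w \<in> carrier_vec n" "w \<noteq> 0\<^sub>v n" and "(mat_adjoint P * C) *\<^sub>v w = 0\<^sub>v k"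
    using wide_mat_kernel[OF mult_carrier_mat[OF P' cC] \<open>k < n\<close>] by blast
  then have orth: "mat_adjoint P *\<^sub>v (C *\<^sub>v w) = 0\<^sub>v k"
    using assoc_mult_mat_vec[OF P' cC w(1)] by simp
  let ?P = "append_col P w"
  have inj': "inj_mat n (Suc k) ?P" using inj_mat_append_col[OF C inj w orth] .
  then have cP: "?P \<in> carrier_mat n (Suc k)" by (simp add: inj_mat_def)
  define d where "d M = Re (det (mat_adjoint P * M * P))" for M
  define d' where "d' M = Re (det (mat_adjoint ?P * M * ?P))" for M
  define q where "q M = Re ((M *\<^sub>v w) \<bullet>c w)" for M
  have pos: "0 < d M" "0 < d' M" "0 < q M" if "hermitian_pos_def n M" for M
    using hpd_det_pos(2)[OF hpd_compression[OF that inj]]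
      hpd_det_pos(2)[OF hpd_compression[OF that inj']] hpd_pos[OF that w]
    by (simp_all add: d_def d'_def q_def)
  have fischer: "ln (d' M) \<le> ln (d M) + ln (q M)" if "hermitian_pos_def n M" for M
  proof -
    have "ln (d' M) \<le> ln (d M * q M)"
      using fischer_append_col[OF that inj w(1)] pos[OF that] by (simp add: d_def d'_def q_def)
    then show ?thesis using pos[OF that] by (simp add: ln_mult)
  qed
  \<comment> \<open>For the midpoint, Fischer's bound is attained, because \<open>w\<close> was
    chosen orthogonal with respect to \<open>C\<close>.\<close>
  have "d' C = d C * q C"
    using det_compression_append_orthogonal[OF P w(1) cC orth] hpd_real[OF C w(1)]
      hpd_det_pos(1)[OF hpd_compression[OF C inj]]
    unfolding d_def d'_def q_def by (metis Re_complex_of_real of_real_mult)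
  then have dC: "ln (d' C) = ln (d C) + ln (q C)" using pos[OF C] by (simp add: ln_mult)
  \<comment> \<open>Arithmetic-geometric mean inequality in squared form, with \<open>q C\<close>
    the mean of \<open>q A\<close> and \<open>q B\<close>.\<close>
  have "q A * q B \<le> (q C)\<^sup>2"
  proof -
    have qC: "q C = (q A + q B) / 2" unfolding q_def C_def using hpd_midpoint(2)[OF A B w(1)] .
    have "(q C)\<^sup>2 - q A * q B = ((q A - q B) / 2)\<^sup>2"
      unfolding qC by (simp add: field_simps power2_eq_square)
    then show ?thesis by (metis diff_ge_0_iff_ge zero_le_power2)
  qed
  then have "ln (q A * q B) \<le> ln ((q C)\<^sup>2)" using pos[OF A] pos[OF B] pos[OF C] by simp
  then have amgm: "ln (q A) + ln (q B) \<le> 2 * ln (q C)"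
    using pos[OF A] pos[OF B] pos[OF C] by (simp add: ln_mult ln_realpow)
  have "delta_S_sq (mat_adjoint P * A * P) (mat_adjoint P * B * P)
      = ln (d C) - (ln (d A) + ln (d B)) / 2"
    using delta_S_sq_hpd[OF hpd_compression[OF A inj] hpd_compression[OF B inj]]
      compression_midpoint[OF P cA cB] by (simp add: d_def C_def)
  \<comment> \<open>The term for \<open>C\<close> grows by exactly \<open>ln (q C)\<close>, while
    the subtracted mean grows by at most the mean of \<open>ln (q A)\<close> and
    \<open>ln (q B)\<close>.\<close>
  also have "\<dots> \<le> ln (d' C) - (ln (d' A) + ln (d' B)) / 2"
    using dC fischer[OF A] fischer[OF B] amgm by argo
  also have "\<dots> = delta_S_sq (mat_adjoint ?P * A * ?P) (mat_adjoint ?P * B * ?P)"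
    using delta_S_sq_hpd[OF hpd_compression[OF A inj'] hpd_compression[OF B inj']]
      compression_midpoint[OF cP cA cB] by (simp add: d'_def C_def)
  finally show thesis using that inj' by blast
qed

text \<open>All three log-determinants shift by the logarithm of the squared modulus of
  \<open>det P\<close>; with weights 1, -1/2 and -1/2 the shifts cancel.\<close>

lemma delta_S_sq_congruence:
  assumes A: "hermitian_pos_def n A" and B: "hermitian_pos_def n B" and inj: "inj_mat n n P"
  shows "delta_S_sq (mat_adjoint P * A * P) (mat_adjoint P * B * P) = delta_S_sq A B"
proof -
  define C where "C = (1 / 2) \<cdot>\<^sub>m (A + B)"
  have C: "hermitian_pos_def n C" unfolding C_def using A B by (rule hpd_midpoint)
  have P: "P \<in> carrier_mat n n" using inj by (simp add: inj_mat_def)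
  have "det P \<noteq> 0" using det_0_iff_vec_prod_zero[OF P] inj by (auto simp: inj_mat_def)
  then have p: "0 < (cmod (det P))\<^sup>2" by simp
  have ln: "ln (Re (det (mat_adjoint P * M * P))) = ln ((cmod (det P))\<^sup>2) + ln (Re (det M))"
    if M: "hermitian_pos_def n M" for M
  proof -
    note cM = hpd_carrier[OF M]
    \<comment> \<open>The congruence is read as a compression by the identity followed by the square
      factor \<open>P\<close>, so that \<open>det_compression_mult\<close> applies.\<close>
    have "mat_adjoint (1\<^sub>m n) = (1\<^sub>m n :: complex mat)" by (intro eq_matI) auto
    then have "det (mat_adjoint P * M * P) = of_real ((cmod (det P))\<^sup>2) * det M"
      using det_compression_mult[OF one_carrier_mat cM P]
      by (simp only: left_mult_one_mat[OF P] left_mult_one_mat[OF cM] right_mult_one_mat[OF cM])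
    then have "Re (det (mat_adjoint P * M * P)) = (cmod (det P))\<^sup>2 * Re (det M)"
      by (simp only: Re_complex_of_real times_complex.sel Im_complex_of_real)
    then show ?thesis using p hpd_det_pos(2)[OF M] by (simp add: ln_mult)
  qed
  have "delta_S_sq (mat_adjoint P * A * P) (mat_adjoint P * B * P)
      = ln (Re (det (mat_adjoint P * C * P)))
        - (ln (Re (det (mat_adjoint P * A * P))) + ln (Re (det (mat_adjoint P * B * P)))) / 2"
    unfolding delta_S_sq_hpd[OF hpd_compression[OF A inj] hpd_compression[OF B inj]] C_def
      compression_midpoint[OF P hpd_carrier[OF A] hpd_carrier[OF B]] ..
  also have "\<dots> = delta_S_sq A B"
    unfolding ln[OF A] ln[OF B] ln[OF C] delta_S_sq_hpd[OF A B] unfolding C_def by argo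
  finally show ?thesis .
qed

theorem theorem4p15:
  fixes n k :: nat and P :: "complex mat"
  assumes "k \<le> n"
    and "P \<in> carrier_mat n k"
    and "vec_space.rank n P = k"
  shows "\<forall>A B. hermitian_pos_def n A \<and> hermitian_pos_def n B \<longrightarrow>
           delta_S_sq (mat_adjoint P * A * P) (mat_adjoint P * B * P) \<le> delta_S_sq A B"
proof (intro allI impI, elim conjE)
  fix A B assume A: "hermitian_pos_def n A" and B: "hermitian_pos_def n B"
  have "inj_mat n k P" using inj_mat_if_full_rank assms(2,3) .
  with \<open>k \<le> n\<close> show "delta_S_sq (mat_adjoint P * A * P) (mat_adjoint P * B * P) \<le> delta_S_sq A B"
  \<comment> \<open>The induction descends from the square case, where \<open>k\<close> equals
    \<open>n\<close>. \<open>P\<close> is generalized because the induction hypothesis is applied to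
    the enlarged matrix.\<close>
  proof (induction k arbitrary: P rule: inc_induct)
    case base
    then show ?case using delta_S_sq_congruence[OF A B] by simp
  next
    case (step k)
    obtain w where w: "inj_mat n (Suc k) (append_col P w)"
      and le: "delta_S_sq (mat_adjoint P * A * P) (mat_adjoint P * B * P)
        \<le> delta_S_sq (mat_adjoint (append_col P w) * A * append_col P w)
            (mat_adjoint (append_col P w) * B * append_col P w)"
      using delta_S_sq_append_col[OF A B step.prems step.hyps(2)] .
    from le step.IH[OF w] show ?case by (rule order_trans)
  qed
qed

end
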